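(* Suppose that each $P\in\mathcal{P}$ is supported. For any $S\in\mathcal{S}$, the following are equivalent: (i) $\operatorname{NA}(\mathcal{P},S)$ holds. (ii) For all $P\in\mathcal{P}$ there exists $Q\in\mathfrak{M}(S)$ such that $P\ll Q$.
   Context: $(\Omega,\mathcal{F})$ is a measurable space and $\mathcal{P}$ is a non-empty set of probability measures on it; $c(A):=\sup_{P\in\mathcal{P}}P(A)$ for $A\in\mathcal{F}$. An event $A\in\mathcal{F}$ is $\mathcal{P}$-polar if $c(A)=0$; a property holds $\mathcal{P}$-q.s. if it holds outside a $\mathcal{P}$-polar event. $\mathfrak{P}_c(\Omega)$ is the set of probability measures on $(\Omega,\mathcal{F})$ vanishing on all $\mathcal{P}$-polar events. $Q\in\mathfrak{P}_c(\Omega)$ is supported if there is $S(Q)\in\mathcal{F}$ such that $Q(S(Q)^c)=0$ and, whenever $N\in\mathcal{F}$ satisfies $Q(N)=0$, $N\cap S(Q)$ is $\mathcal{P}$-polar. A one-period market model of dimension $d\in\mathbb{N}$ is $S=(S_0,S_1)$ with $S_0\in\mathbb{R}^d$ and $S_1$ a bounded $d$-dimensional random vector on $(\Omega,\mathcal{F})$, all coordinates of $S_0,S_1$ being non-negative; $\mathcal{S}$ is the collection of all such models of all dimensions $d\in\mathbb{N}$; $d(S)$ is the dimension of $S$; $\Delta S:=S_1-S_0$; for $H\in\mathbb{R}^{d(S)}$, $H\Delta S$ is the ($\omega$-wise) Euclidean scalar product. $\operatorname{NA}(\mathcal{P},S)$ holds if for all $H\in\mathbb{R}^{d(S)}$,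 $H\Delta S\ge0$ $\mathcal{P}$-q.s. implies $H\Delta S=0$ $\mathcal{P}$-q.s. $\mathfrak{M}(S):=\{Q\in\mathfrak{P}_c(\Omega)\mid E_Q[\Delta S^i]=0\text{ for all }i=1,\dots,d(S)\}$ is the set of martingale measures for $S$ in $\mathfrak{P}_c(\Omega)$. *)

theory Defs
  imports "HOL-Probability.Probability"
begin

text \<open>
  The measurable space is given by a measure \<open>M\<close> of which only \<open>space M\<close> and \<open>sets M\<close> are used;
  a set of probability measures on it is a set of measures with the same \<open>sets\<close>.
  Mind the argument order of the library constant: \<^const>\<open>absolutely_continuous\<close> \<open>Q P\<close> means
  that every \<open>Q\<close>-null set is \<open>P\<close>-null, i.e. that \<open>P\<close> is dominated by \<open>Q\<close>.
\<close>

definition prob_measures_on :: "'a measure \<Rightarrow> 'a measure set" where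
  "prob_measures_on M = {Q. prob_space Q \<and> sets Q = sets M}"

definition upper_prob :: "'a measure set \<Rightarrow> 'a set \<Rightarrow> ennreal" where
  "upper_prob \<P> A = (SUP P\<in>\<P>. emeasure P A)"

definition polar :: "'a measure \<Rightarrow> 'a measure set \<Rightarrow> 'a set \<Rightarrow> bool" where
  "polar M \<P> A \<longleftrightarrow> A \<in> sets M \<and> upper_prob \<P> A = 0"

definition quasi_surely :: "'a measure \<Rightarrow> 'a measure set \<Rightarrow> ('a \<Rightarrow> bool) \<Rightarrow> bool" where
  "quasi_surely M \<P> \<phi> \<longleftrightarrow> (\<exists>N. polar M \<P> N \<and> (\<forall>\<omega>\<in>space M - N. \<phi> \<omega>))"

definition ac_prob_measures :: "'a measure \<Rightarrow> 'a measure set \<Rightarrow> 'a measure set" where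
  "ac_prob_measures M \<P> = {Q \<in> prob_measures_on M. \<forall>N. polar M \<P> N \<longrightarrow> emeasure Q N = 0}"

definition supported :: "'a measure \<Rightarrow> 'a measure set \<Rightarrow> 'a measure \<Rightarrow> bool" where
  "supported M \<P> Q \<longleftrightarrow> Q \<in> ac_prob_measures M \<P> \<and>
     (\<exists>S\<in>sets M. emeasure Q (space M - S) = 0 \<and>
        (\<forall>N\<in>sets M. emeasure Q N = 0 \<longrightarrow> polar M \<P> (N \<inter> S)))"

text \<open>
  One-period market models of dimension \<open>CARD('d)\<close>; the dimension is a (nonzero) type parameter,
  so a statement about all models of all dimensions is one that is polymorphic in \<open>'d\<close>.
  Boundedness and non-negativity of the terminal prices are required pointwise on \<open>space M\<close>.
\<close>

type_synonym ('a, 'd) market = "(real ^ 'd) \<times> ('a \<Rightarrow> real ^ 'd)"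

definition market_models :: "'a measure \<Rightarrow> ('a, 'd::finite) market set" where
  "market_models M = {(S0, S1).
     S1 \<in> borel_measurable M \<and> bounded (S1 ` space M) \<and>
     (\<forall>i. 0 \<le> S0 $ i) \<and> (\<forall>\<omega>\<in>space M. \<forall>i. 0 \<le> S1 \<omega> $ i)}"

definition price_change :: "('a, 'd::finite) market \<Rightarrow> 'a \<Rightarrow> real ^ 'd" where
  "price_change S \<omega> = snd S \<omega> - fst S"

definition no_arbitrage ::
    "'a measure \<Rightarrow> 'a measure set \<Rightarrow> ('a, 'd::finite) market \<Rightarrow> bool" where
  "no_arbitrage M \<P> S \<longleftrightarrow> (\<forall>H :: real ^ 'd.
     quasi_surely M \<P> (\<lambda>\<omega>. 0 \<le> H \<bullet> price_change S \<omega>) \<longrightarrow>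
     quasi_surely M \<P> (\<lambda>\<omega>. H \<bullet> price_change S \<omega> = 0))"

text \<open>
  For models in \<^const>\<open>market_models\<close> the price changes are bounded and measurable, so the
  integrals below are genuine expectations.
\<close>

definition martingale_measures ::
    "'a measure \<Rightarrow> 'a measure set \<Rightarrow> ('a, 'd::finite) market \<Rightarrow> 'a measure set" where
  "martingale_measures M \<P> S =
     {Q \<in> ac_prob_measures M \<P>. \<forall>i. (\<integral>\<omega>. price_change S \<omega> $ i \<partial>Q) = 0}"

end

theory Submission
  imports Defs
begin

text \<open>
  Fix \<open>P \<in> \<P>\<close> and let \<open>\<Theta>\<close> be the set of those measures in \<^const>\<open>ac_prob_measures\<close> that dominate \<open>P\<close>.
  It contains \<open>P\<close> and is convex, so the expectations of the price change under the members of
  \<open>\<Theta>\<close> form a nonempty convex set \<open>K\<close> in Euclidean space, and a martingale measure dominating \<open>P\<close>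
  exists exactly when \<open>0 \<in> K\<close>.

  If \<open>0 \<notin> K\<close>, a nonzero vector \<open>H\<close> in the linear span of \<open>K\<close> satisfies \<open>0 \<le> H \<bullet> x\<close> on \<open>K\<close>. The set
  \<open>\<Theta>\<close> is rich enough for this to force \<open>H\<close> to have a nonnegative payoff quasi-surely: if some member
  of \<open>\<P>\<close> charged the event of a negative payoff, then conditioning it on that event and adding a small
  multiple of \<open>P\<close> would give a member of \<open>\<Theta>\<close> with negative expected payoff
  (\<open>nonneg_expectation_imp_nonneg_quasi_surely\<close>). By absence of arbitrage the payoff of \<open>H\<close> then
  vanishes quasi-surely, so \<open>H\<close> is orthogonal to \<open>K\<close>, hence to its span and to itself: a
  contradiction. Choosing \<open>H\<close> inside the span is what replaces a separation argument relative to the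
  affine hull, and a separate treatment of redundant assets.

  Conversely, a nonnegative payoff with zero expectation under a martingale measure \<open>Q\<close> vanishes
  \<open>Q\<close>-almost surely, hence \<open>P\<close>-almost surely for every \<open>P\<close> dominated by \<open>Q\<close>. If every \<open>P \<in> \<P>\<close> is
  dominated in this way, the payoff vanishes quasi-surely.
\<close>

section \<open>Quasi-sure statements\<close>

lemma polar_iff:
  "polar M \<P> A \<longleftrightarrow> A \<in> sets M \<and> (\<forall>P\<in>\<P>. emeasure P A = 0)"
  unfolding polar_def upper_prob_def by (simp flip: bot_ennreal)

lemma prob_measures_onD:
  assumes "Q \<in> prob_measures_on M"
  shows "prob_space Q" and "sets Q = sets M" and "space Q = space M"
  using assms sets_eq_imp_space_eq unfolding prob_measures_on_def by auto

lemma ac_prob_measuresD: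
  assumes "Q \<in> ac_prob_measures M \<P>"
  shows "Q \<in> prob_measures_on M" and "polar M \<P> N \<Longrightarrow> emeasure Q N = 0"
  using assms unfolding ac_prob_measures_def by auto

lemma member_ac_prob_measures:
  assumes "\<P> \<subseteq> prob_measures_on M" and "P \<in> \<P>"
  shows "P \<in> ac_prob_measures M \<P>"
  using assms unfolding ac_prob_measures_def by (auto simp: polar_iff)

lemma quasi_surely_imp_AE:
  assumes "Q \<in> ac_prob_measures M \<P>" and "quasi_surely M \<P> \<phi>"
  shows "AE \<omega> in Q. \<phi> \<omega>"
proof -
  from assms(2) obtain N where N: "polar M \<P> N" "\<And>\<omega>. \<omega> \<in> space M - N \<Longrightarrow> \<phi> \<omega>"
    unfolding quasi_surely_def by auto
  note Q = prob_measures_onD[OF ac_prob_measuresD(1)[OF assms(1)]]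
  show ?thesis
  proof (rule AE_I)
    show "{\<omega> \<in> space Q. \<not> \<phi> \<omega>} \<subseteq> N" using N(2) Q(3) by auto
    show "emeasure Q N = 0" using ac_prob_measuresD(2)[OF assms(1) N(1)] .
    show "N \<in> sets Q" using N(1) Q(2) by (simp add: polar_iff)
  qed
qed

text \<open>
  For a measurable property the exceptional sets of the individual \<open>P\<close>, which need not be chosen
  uniformly, can all be replaced by the set where the property fails.
\<close>

lemma AE_imp_quasi_surely:
  assumes "\<P> \<subseteq> prob_measures_on M" and "{\<omega> \<in> space M. \<not> \<phi> \<omega>} \<in> sets M"
    and "\<And>P. P \<in> \<P> \<Longrightarrow> AE \<omega> in P. \<phi> \<omega>"
  shows "quasi_surely M \<P> \<phi>"
  unfolding quasi_surely_def
proof (intro exI conjI ballI)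
  have "emeasure P {\<omega> \<in> space M. \<not> \<phi> \<omega>} = 0" if "P \<in> \<P>" for P
    using assms(3)[OF that] prob_measures_onD[of P M] that assms(1,2)
    by (subst (asm) AE_iff_measurable[of "{\<omega> \<in> space M. \<not> \<phi> \<omega>}"]) auto
  then show "polar M \<P> {\<omega> \<in> space M. \<not> \<phi> \<omega>}"
    using assms(2) by (simp add: polar_iff)
qed auto

section \<open>Mixing and conditioning measures\<close>

text \<open>
  The convex combination of two probability measures, as the law of drawing the measure by a
  coin toss and then drawing from it.
\<close>

definition mixture :: "real \<Rightarrow> 'a measure \<Rightarrow> 'a measure \<Rightarrow> 'a measure" where
  "mixture t P Q = measure_pmf (bernoulli_pmf t) \<bind> (\<lambda>b. if b then P else Q)"

context
  fixes M :: "'a measure" and P Q :: "'a measure" and t :: real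
  assumes P: "P \<in> prob_measures_on M" and Q: "Q \<in> prob_measures_on M"
    and t: "0 \<le> t" "t \<le> 1"
begin

lemma mixture_kernel:
  "(\<lambda>b. if b then P else Q) \<in> measure_pmf (bernoulli_pmf t) \<rightarrow>\<^sub>M prob_algebra M"
  using prob_measures_onD[OF P] prob_measures_onD[OF Q]
  by (auto simp: measurable_def space_prob_algebra)

lemma bernoulli_in_prob_algebra:
  "measure_pmf (bernoulli_pmf t) \<in> space (prob_algebra (measure_pmf (bernoulli_pmf t)))"
  by (simp add: space_prob_algebra prob_space_measure_pmf)

lemma mixture_in_prob_measures_on: "mixture t P Q \<in> prob_measures_on M"
  unfolding mixture_def prob_measures_on_def
  using prob_space_bind'[OF bernoulli_in_prob_algebra mixture_kernel]
    sets_bind'[OF bernoulli_in_prob_algebra mixture_kernel] by simp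

lemma emeasure_mixture:
  assumes "A \<in> sets M"
  shows "emeasure (mixture t P Q) A = emeasure P A * ennreal t + emeasure Q A * ennreal (1 - t)"
  unfolding mixture_def
  using t by (subst emeasure_bind_prob_algebra[OF bernoulli_in_prob_algebra mixture_kernel assms])
    simp

lemma integral_mixture:
  fixes f :: "'a \<Rightarrow> real"
  assumes "f \<in> borel_measurable M" and "\<And>\<omega>. \<omega> \<in> space M \<Longrightarrow> \<bar>f \<omega>\<bar> \<le> B"
  shows "(\<integral>\<omega>. f \<omega> \<partial>mixture t P Q) = t * (\<integral>\<omega>. f \<omega> \<partial>P) + (1 - t) * (\<integral>\<omega>. f \<omega> \<partial>Q)"
proof -
  have "(\<integral>\<omega>. f \<omega> \<partial>mixture t P Q)
      = (\<integral>b. (\<integral>\<omega>. f \<omega> \<partial>(if b then P else Q)) \<partial>measure_pmf (bernoulli_pmf t))"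
    unfolding mixture_def
  proof (rule integral_bind[where K = M and B = B and B' = 1])
    show "AE b in measure_pmf (bernoulli_pmf t).
        emeasure (if b then P else Q) (space (if b then P else Q)) \<le> ennreal 1"
      using prob_space.emeasure_space_1[OF prob_measures_onD(1)[OF P]]
        prob_space.emeasure_space_1[OF prob_measures_onD(1)[OF Q]]
      by simp
  next
    show "(\<lambda>b. if b then P else Q)
        \<in> measure_pmf (bernoulli_pmf t) \<rightarrow>\<^sub>M subprob_algebra M"
      by (rule measurable_prob_algebraD[OF mixture_kernel])
  qed (use assms in auto)
  then show ?thesis using t by (simp add: algebra_simps)
qed

end

lemma mixture_in_ac_prob_measures:
  assumes "P \<in> ac_prob_measures M \<P>" and "Q \<in> ac_prob_measures M \<P>" and "0 \<le> t" "t \<le> 1"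
  shows "mixture t P Q \<in> ac_prob_measures M \<P>"
  using assms mixture_in_prob_measures_on[of P M Q t] emeasure_mixture[of P M Q t]
  unfolding ac_prob_measures_def by (auto simp: polar_iff)

lemma absolutely_continuous_mixture:
  assumes "P \<in> prob_measures_on M" and "Q \<in> prob_measures_on M" and "0 \<le> t" "t < 1"
    and "absolutely_continuous Q R"
  shows "absolutely_continuous (mixture t P Q) R"
proof -
  have "null_sets (mixture t P Q) \<subseteq> null_sets Q"
    using assms mixture_in_prob_measures_on[of P M Q t] emeasure_mixture[of P M Q t]
    by (auto simp: null_sets_def prob_measures_onD)
  then show ?thesis using assms(5) unfolding absolutely_continuous_def by auto
qed

lemma uniform_measure_in_ac_prob_measures:
  assumes "Q \<in> ac_prob_measures M \<P>" and "A \<in> sets M" and "emeasure Q A \<noteq> 0"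
  shows "uniform_measure Q A \<in> ac_prob_measures M \<P>"
proof -
  note Q = prob_measures_onD[OF ac_prob_measuresD(1)[OF assms(1)]]
  interpret prob_space Q by (rule Q(1))
  have "prob_space (uniform_measure Q A)"
    using assms(3) by (intro prob_space_uniform_measure) auto
  moreover have "emeasure (uniform_measure Q A) N = 0" if "polar M \<P> N" for N
  proof -
    have N: "N \<in> sets Q" "emeasure Q N = 0"
      using that ac_prob_measuresD(2)[OF assms(1)] Q(2) by (auto simp: polar_iff)
    then have "emeasure Q (A \<inter> N) = 0"
      by (metis emeasure_mono inf_le2 le_zero_eq)
    then show ?thesis using N(1) assms(2) Q(2) by simp
  qed
  ultimately show ?thesis
    using Q(2) unfolding ac_prob_measures_def prob_measures_on_def by simp
qed

section \<open>Expectations of a bounded random vector\<close>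

context
  fixes M :: "'a measure" and \<P> :: "'a measure set" and X :: "'a \<Rightarrow> 'b::euclidean_space"
  assumes X_measurable: "X \<in> borel_measurable M" and X_bounded: "bounded (X ` space M)"
begin

lemma integrable_bounded_vector:
  assumes "Q \<in> prob_measures_on M"
  shows "integrable Q X"
proof -
  note Q = prob_measures_onD[OF assms]
  interpret prob_space Q by (rule Q(1))
  obtain B where "\<And>\<omega>. \<omega> \<in> space M \<Longrightarrow> norm (X \<omega>) \<le> B"
    using X_bounded unfolding bounded_iff by auto
  then show ?thesis
    using X_measurable Q(3) measurable_cong_sets[OF Q(2) refl]
    by (intro integrable_const_bound[where B = B]) auto
qed

lemma expectation_inner:
  assumes "Q \<in> prob_measures_on M"
  shows "(\<integral>\<omega>. H \<bullet> X \<omega> \<partial>Q) = H \<bullet> (\<integral>\<omega>. X \<omega> \<partial>Q)"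
  using integrable_bounded_vector[OF assms] by simp

lemma expectation_mixture:
  assumes "P \<in> prob_measures_on M" and "Q \<in> prob_measures_on M" and "0 \<le> t" "t \<le> 1"
  shows "(\<integral>\<omega>. X \<omega> \<partial>mixture t P Q) = t *\<^sub>R (\<integral>\<omega>. X \<omega> \<partial>P) + (1 - t) *\<^sub>R (\<integral>\<omega>. X \<omega> \<partial>Q)"
proof -
  obtain B where B: "\<And>\<omega>. \<omega> \<in> space M \<Longrightarrow> norm (X \<omega>) \<le> B"
    using X_bounded unfolding bounded_iff by auto
  have "H \<bullet> (\<integral>\<omega>. X \<omega> \<partial>mixture t P Q)
      = H \<bullet> (t *\<^sub>R (\<integral>\<omega>. X \<omega> \<partial>P) + (1 - t) *\<^sub>R (\<integral>\<omega>. X \<omega> \<partial>Q))" for H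
  proof -
    have "\<bar>H \<bullet> X \<omega>\<bar> \<le> norm H * B" if "\<omega> \<in> space M" for \<omega>
      using Cauchy_Schwarz_ineq2[of H "X \<omega>"] mult_left_mono[OF B[OF that], of "norm H"] by simp
    moreover have "(\<lambda>\<omega>. H \<bullet> X \<omega>) \<in> borel_measurable M"
      using X_measurable by measurable
    ultimately have "(\<integral>\<omega>. H \<bullet> X \<omega> \<partial>mixture t P Q)
        = t * (\<integral>\<omega>. H \<bullet> X \<omega> \<partial>P) + (1 - t) * (\<integral>\<omega>. H \<bullet> X \<omega> \<partial>Q)"
      by (intro integral_mixture[OF assms])
    then show ?thesis
      using assms mixture_in_prob_measures_on[OF assms]
      by (simp only: expectation_inner inner_add_right inner_scaleR_right)
  qed
  then show ?thesis using vector_eq_ldot by blast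
qed

text \<open>
  A negative payoff charged by some \<open>P' \<in> \<P>\<close> is detected by the measures dominating \<open>P\<close>: the
  conditional measure of \<open>P'\<close> given that event has negative expectation, and this survives the
  admixture of a small multiple of \<open>P\<close>, which restores domination of \<open>P\<close>.
\<close>

lemma nonneg_expectation_imp_nonneg_quasi_surely:
  assumes "\<P> \<subseteq> prob_measures_on M" and P: "P \<in> ac_prob_measures M \<P>"
    and nonneg: "\<And>R. R \<in> ac_prob_measures M \<P> \<Longrightarrow> absolutely_continuous R P \<Longrightarrow>
        0 \<le> H \<bullet> (\<integral>\<omega>. X \<omega> \<partial>R)"
  shows "quasi_surely M \<P> (\<lambda>\<omega>. 0 \<le> H \<bullet> X \<omega>)"
proof (rule AE_imp_quasi_surely[OF assms(1)])
  define A where "A = {\<omega> \<in> space M. \<not> 0 \<le> H \<bullet> X \<omega>}"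
  have A: "A \<in> sets M"
    unfolding A_def using X_measurable by measurable
  then show "{\<omega> \<in> space M. \<not> 0 \<le> H \<bullet> X \<omega>} \<in> sets M" by (simp add: A_def)
  fix P' assume "P' \<in> \<P>"
  then have P': "P' \<in> ac_prob_measures M \<P>" using assms(1) by (rule member_ac_prob_measures[rotated])
  note P'_D = prob_measures_onD[OF ac_prob_measuresD(1)[OF P']]
  interpret P': prob_space P' by (rule P'_D(1))
  have "emeasure P' A = 0"
  proof (rule ccontr)
    assume pos: "emeasure P' A \<noteq> 0"
    define U where "U = uniform_measure P' A"
    have U: "U \<in> ac_prob_measures M \<P>"
      unfolding U_def using P' A pos by (rule uniform_measure_in_ac_prob_measures)
    note U_prob = ac_prob_measuresD(1)[OF U] and P_prob = ac_prob_measuresD(1)[OF P]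
    interpret U: prob_space U by (rule prob_measures_onD(1)[OF U_prob])
    define a b where "a = H \<bullet> (\<integral>\<omega>. X \<omega> \<partial>U)" and "b = H \<bullet> (\<integral>\<omega>. X \<omega> \<partial>P)"
    have "AE \<omega> in U. H \<bullet> X \<omega> < 0"
      unfolding U_def using A P'_D(2) by (intro AE_uniform_measureI) (auto simp: A_def)
    then have "a < 0"
      unfolding a_def expectation_inner[OF U_prob, symmetric]
      using integrable_bounded_vector[OF U_prob] by (intro U.expectation_less) auto
    have "0 \<le> b"
      unfolding b_def using nonneg[OF P] by (simp add: absolutely_continuous_def)
    \<comment> \<open>the weight of \<open>P\<close> for which the mixture gives \<open>H \<bullet> X\<close> the expectation \<open>a / 2\<close>\<close>
    define e where "e = a / (2 * (a - b))"
    have e: "0 < e" "e \<le> 1"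
      using \<open>a < 0\<close> \<open>0 \<le> b\<close> unfolding e_def by (auto simp: divide_simps)
    have "0 \<le> H \<bullet> (\<integral>\<omega>. X \<omega> \<partial>mixture (1 - e) U P)"
    proof (rule nonneg)
      show "mixture (1 - e) U P \<in> ac_prob_measures M \<P>"
        using U P e by (intro mixture_in_ac_prob_measures) auto
      show "absolutely_continuous (mixture (1 - e) U P) P"
        using U_prob P_prob e by (intro absolutely_continuous_mixture[where M = M])
          (auto simp: absolutely_continuous_def)
    qed
    also have "\<dots> = (1 - e) * a + e * b"
      using e by (subst expectation_mixture[OF U_prob P_prob])
        (auto simp: a_def b_def inner_add_right)
    also have "\<dots> = a - e * (a - b)" by (simp add: algebra_simps)
    also have "\<dots> = a / 2" using \<open>a < 0\<close> \<open>0 \<le> b\<close> unfolding e_def by (simp add: divide_simps)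
    finally show False using \<open>a < 0\<close> by simp
  qed
  then show "AE \<omega> in P'. 0 \<le> H \<bullet> X \<omega>"
    using A P'_D by (subst AE_iff_measurable[of A]) (auto simp: A_def)
qed

lemma expectation_eq_zero_quasi_surely:
  assumes "Q \<in> ac_prob_measures M \<P>" and "quasi_surely M \<P> (\<lambda>\<omega>. H \<bullet> X \<omega> = 0)"
  shows "H \<bullet> (\<integral>\<omega>. X \<omega> \<partial>Q) = 0"
  unfolding expectation_inner[OF ac_prob_measuresD(1)[OF assms(1)], symmetric]
  by (rule integral_eq_zero_AE[OF quasi_surely_imp_AE[OF assms]])

text \<open>
  The separating vector is taken in the span of the set of expectations, so that being orthogonal
  to all expectations makes it zero.
\<close>

lemma ex_dominating_measure_with_zero_expectation:
  assumes "\<P> \<subseteq> prob_measures_on M" and P: "P \<in> ac_prob_measures M \<P>"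
    and no_arb: "\<And>H. quasi_surely M \<P> (\<lambda>\<omega>. 0 \<le> H \<bullet> X \<omega>) \<Longrightarrow>
        quasi_surely M \<P> (\<lambda>\<omega>. H \<bullet> X \<omega> = 0)"
  obtains Q where "Q \<in> ac_prob_measures M \<P>" "absolutely_continuous Q P" "(\<integral>\<omega>. X \<omega> \<partial>Q) = 0"
proof -
  define \<Theta> where "\<Theta> = {R \<in> ac_prob_measures M \<P>. absolutely_continuous R P}"
  define K where "K = (\<lambda>R. \<integral>\<omega>. X \<omega> \<partial>R) ` \<Theta>"
  have "P \<in> \<Theta>" using P by (simp add: \<Theta>_def absolutely_continuous_def)
  then have "K \<noteq> {}" by (auto simp: K_def)
  have mixture_\<Theta>: "mixture t R R' \<in> \<Theta>" if "R \<in> \<Theta>" "R' \<in> \<Theta>" "0 \<le> t" "t < 1" for R R' t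
    using that mixture_in_ac_prob_measures[of R M \<P> R' t]
      absolutely_continuous_mixture[of R M R' t P]
    by (auto simp: \<Theta>_def dest: ac_prob_measuresD(1))
  have "convex K"
  proof (rule convexI)
    fix x y :: 'b and u v :: real
    assume "x \<in> K" "y \<in> K" and uv: "0 \<le> u" "0 \<le> v" "u + v = 1"
    then obtain R R' where R: "R \<in> \<Theta>" "x = (\<integral>\<omega>. X \<omega> \<partial>R)" and R': "R' \<in> \<Theta>" "y = (\<integral>\<omega>. X \<omega> \<partial>R')"
      by (auto simp: K_def)
    show "u *\<^sub>R x + v *\<^sub>R y \<in> K"
    proof (cases "u = 1")
      case True
      then show ?thesis using uv \<open>x \<in> K\<close> by simp
    next
      case False
      then have "mixture u R R' \<in> \<Theta>" using uv R(1) R'(1) by (intro mixture_\<Theta>) auto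
      moreover have "(\<integral>\<omega>. X \<omega> \<partial>mixture u R R') = u *\<^sub>R x + (1 - u) *\<^sub>R y"
        unfolding R(2) R'(2) using uv R(1) R'(1)
        by (intro expectation_mixture) (auto simp: \<Theta>_def dest: ac_prob_measuresD(1))
      moreover have "v = 1 - u" using uv by simp
      ultimately show ?thesis unfolding K_def by (metis image_eqI)
    qed
  qed
  have "0 \<in> K"
  proof (rule ccontr)
    assume "0 \<notin> K"
    then obtain H where H: "H \<in> span K" "H \<noteq> 0" "\<And>x. x \<in> K \<Longrightarrow> 0 \<le> H \<bullet> x"
      using separating_hyperplane_set_0_inspan[OF \<open>convex K\<close> \<open>K \<noteq> {}\<close>] by blast
    have "quasi_surely M \<P> (\<lambda>\<omega>. 0 \<le> H \<bullet> X \<omega>)"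
      using assms(1) P H(3) by (intro nonneg_expectation_imp_nonneg_quasi_surely)
        (auto simp: K_def \<Theta>_def)
    then have zero: "quasi_surely M \<P> (\<lambda>\<omega>. H \<bullet> X \<omega> = 0)" by (rule no_arb)
    have "orthogonal H x" if "x \<in> K" for x
      using that expectation_eq_zero_quasi_surely[OF _ zero]
      by (auto simp: K_def \<Theta>_def orthogonal_def)
    then have "orthogonal H H" using H(1) orthogonal_to_span by blast
    then show False using H(2) by (simp add: orthogonal_def)
  qed
  then show thesis using that by (auto simp: K_def \<Theta>_def)
qed

text \<open>
  The dominating measure \<open>Q\<close> depends on \<open>P\<close>, and \<open>H \<bullet> X\<close> is zero \<open>P\<close>-almost surely because it is
  a nonnegative variable with zero expectation under \<open>Q\<close>.
\<close>

lemma zero_expectation_imp_zero_quasi_surely: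
  assumes "\<P> \<subseteq> prob_measures_on M"
    and Q: "\<And>P. P \<in> \<P> \<Longrightarrow>
        \<exists>Q\<in>ac_prob_measures M \<P>. absolutely_continuous Q P \<and> (\<integral>\<omega>. X \<omega> \<partial>Q) = 0"
    and nonneg: "quasi_surely M \<P> (\<lambda>\<omega>. 0 \<le> H \<bullet> X \<omega>)"
  shows "quasi_surely M \<P> (\<lambda>\<omega>. H \<bullet> X \<omega> = 0)"
proof (rule AE_imp_quasi_surely[OF assms(1)])
  show "{\<omega> \<in> space M. H \<bullet> X \<omega> \<noteq> 0} \<in> sets M"
    using X_measurable by measurable
  fix P assume "P \<in> \<P>"
  with Q obtain Q where Q: "Q \<in> ac_prob_measures M \<P>" "absolutely_continuous Q P"
    "(\<integral>\<omega>. X \<omega> \<partial>Q) = 0" by blast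
  note Q_prob = ac_prob_measuresD(1)[OF Q(1)]
  have "(\<integral>\<omega>. H \<bullet> X \<omega> \<partial>Q) = 0"
    using expectation_inner[OF Q_prob] Q(3) by simp
  then have "AE \<omega> in Q. H \<bullet> X \<omega> = 0"
    by (subst (asm) integral_nonneg_eq_0_iff_AE)
      (use quasi_surely_imp_AE[OF Q(1) nonneg] integrable_bounded_vector[OF Q_prob] in auto)
  moreover have "sets P = sets Q"
    using prob_measures_onD(2)[OF Q_prob] prob_measures_onD(2)[of P M] \<open>P \<in> \<P>\<close> assms(1)
    by auto
  ultimately show "AE \<omega> in P. H \<bullet> X \<omega> = 0"
    using Q(2) absolutely_continuous_AE by blast
qed

end

section \<open>The fundamental theorem of asset pricing\<close>

lemma price_change_bounded_measurable:
  fixes S :: "('a, 'd::finite) market"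
  assumes "S \<in> market_models M"
  shows "price_change S \<in> borel_measurable M" and "bounded (price_change S ` space M)"
proof -
  have S: "snd S \<in> borel_measurable M" "bounded (snd S ` space M)"
    using assms by (auto simp: market_models_def)
  have eq: "price_change S = (\<lambda>\<omega>. snd S \<omega> - fst S)"
    by (auto simp: price_change_def)
  show "price_change S \<in> borel_measurable M"
    unfolding eq using S(1) by measurable
  have "price_change S ` space M = (\<lambda>x. x - fst S) ` (snd S ` space M)"
    by (auto simp: eq)
  then show "bounded (price_change S ` space M)"
    using bounded_translation_minus[OF S(2)] by simp
qed

lemma martingale_measures_iff:
  fixes S :: "('a, 'd::finite) market"
  assumes "S \<in> market_models M"
  shows "Q \<in> martingale_measures M \<P> S \<longleftrightarrow>
    Q \<in> ac_prob_measures M \<P> \<and> (\<integral>\<omega>. price_change S \<omega> \<partial>Q) = 0"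
proof -
  have "(\<integral>\<omega>. price_change S \<omega> $ i \<partial>Q) = (\<integral>\<omega>. price_change S \<omega> \<partial>Q) $ i"
    if "Q \<in> ac_prob_measures M \<P>" for i
    using expectation_inner[OF price_change_bounded_measurable[OF assms] ac_prob_measuresD(1)[OF that],
        of "axis i 1"]
    by (simp add: inner_axis')
  then show ?thesis
    by (auto simp: martingale_measures_def vec_eq_iff)
qed

theorem corollary4p36:
  fixes M :: "'a measure" and \<P> :: "'a measure set" and S :: "('a, 'd::finite) market"
  assumes "\<P> \<noteq> {}" and "\<P> \<subseteq> prob_measures_on M"
    and "\<And>P. P \<in> \<P> \<Longrightarrow> supported M \<P> P"
    and "S \<in> market_models M"
  shows "no_arbitrage M \<P> S \<longleftrightarrow>
    (\<forall>P\<in>\<P>. \<exists>Q\<in>martingale_measures M \<P> S. absolutely_continuous Q P)"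
proof
  note X = price_change_bounded_measurable[OF assms(4)]
  assume "no_arbitrage M \<P> S"
  then have no_arb: "quasi_surely M \<P> (\<lambda>\<omega>. H \<bullet> price_change S \<omega> = 0)"
    if "quasi_surely M \<P> (\<lambda>\<omega>. 0 \<le> H \<bullet> price_change S \<omega>)" for H
    using that by (simp add: no_arbitrage_def)
  show "\<forall>P\<in>\<P>. \<exists>Q\<in>martingale_measures M \<P> S. absolutely_continuous Q P"
  proof
    fix P assume "P \<in> \<P>"
    then have "P \<in> ac_prob_measures M \<P>" using assms(2) by (intro member_ac_prob_measures)
    then obtain Q where "Q \<in> ac_prob_measures M \<P>" "absolutely_continuous Q P"
      "(\<integral>\<omega>. price_change S \<omega> \<partial>Q) = 0"
      by (rule ex_dominating_measure_with_zero_expectation[OF X assms(2) _ no_arb])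
    then show "\<exists>Q\<in>martingale_measures M \<P> S. absolutely_continuous Q P"
      using martingale_measures_iff[OF assms(4)] by blast
  qed
next
  note X = price_change_bounded_measurable[OF assms(4)]
  assume "\<forall>P\<in>\<P>. \<exists>Q\<in>martingale_measures M \<P> S. absolutely_continuous Q P"
  then have dominating: "\<exists>Q\<in>ac_prob_measures M \<P>. absolutely_continuous Q P \<and>
      (\<integral>\<omega>. price_change S \<omega> \<partial>Q) = 0" if "P \<in> \<P>" for P
    using that martingale_measures_iff[OF assms(4)] by blast
  show "no_arbitrage M \<P> S"
    unfolding no_arbitrage_def
    by (intro allI impI zero_expectation_imp_zero_quasi_surely[OF X assms(2) dominating])
qed

end
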